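(* For $j\in[p]=\{1,\dots,p\}$ let $h^j=f^j+g^j$ with $f^j:\mathbb{R}^n\to\mathbb{R}^m$ continuously differentiable and $g^j:\mathbb{R}^n\to\mathbb{R}^m\cup\{+\infty_C\}$ proper, closed and $C$-convex, and let $H(x)=\{h^1(x),\dots,h^p(x)\}$. Let $x^0\in\mathrm{dom}(H)$ and assume that $H$ satisfies the following: with $\mathcal{L}:=\{x\in\mathbb{R}^n: H(x)\preceq^\ell H(x^0)\}$, for every sequence of sets $\{S_k\}_{k\ge0}$ with each $S_k\in\{H(x):x\in\mathcal{L}\}$ and $S_{k+1}\preceq^\ell S_k$ for all $k$, there exists a bounded set $S\subseteq\mathbb{R}^m$ with $S\preceq^\ell S_k$ for all $k\in\mathbb{N}\cup\{0\}$. Assume that $\nabla f^j$ is Lipschitz continuous with Lipschitz constant $L^j$ for every $j\in[p]$, let $L:=\max\{L^j:j\in[p]\}$, and let $l\ge L$, $l>0$. Let $\{x^k\}$ be an infinite sequence of non-stationary points in $\mathrm{dom}(H)$ of the problem $\preceq^\ell$-$\min_{x\in\mathbb{R}^n} H(x)$, generated from $x^0$ by the proximal gradient method without line search with parameter $l$ (defined in the context). Then there is a constant $\mathcal{C}_2>0$ (independent of $\hat k$) such that for any $\hat k\in\mathbb{N}$ there exists $k\in\{0,1,\dots,\hat k\}$ with $$|\Theta_l(x^k)|<\frac{\mathcal{C}_2}{\hat k}.$$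
   Context: $C\subset\mathbb{R}^m$ is a closed, convex, pointed cone with nonempty interior; $w\preceq_C w'$ iff $w'-w\in C$, $w\prec_C w'$ iff $w'-w\in\mathrm{int}(C)$. The extra element $+\infty_C$ satisfies $w\prec_C+\infty_C$ for all $w\in\mathbb{R}^m$. For sets, $U\preceq^\ell V$ iff $V\subseteq U+C$, i.e. for every $v\in V$ there is $u\in U$ with $u\preceq_C v$. $\mathrm{dom}(H):=\{x:h^j(x)\prec_C+\infty_C\ \forall j\in[p]\}$. $C^*=\{z:w^\top z\ge0\ \forall w\in C\}$, $\mathcal{Z}:=\{z\in C^*:\|z\|=1\}$, $\phi(w):=\sup_{z\in\mathcal{Z}}z^\top w$, with $z^\top(+\infty_C):=+\infty$ for $z\in C^*\setminus\{0\}$ and $\phi(+\infty_C):=+\infty$. $\nabla f^j(x)\in\mathbb{R}^{n\times m}$ is the transposed Jacobian; norms are Euclidean on vectors and the induced operator norm on matrices. $\mathbb{N}=\{1,2,\dots\}$. A function $g:\mathbb{R}^n\to\mathbb{R}^m\cup\{+\infty_C\}$ is $C$-convex if $g(\lambda x+(1-\lambda)y)\preceq_C\lambda g(x)+(1-\lambda)g(y)$ for all $x,y$ and $\lambda\in(0,1]$; proper if not identically $+\infty_C$; closed if $x\mapsto z^\top g(x)$ is lower semicontinuous for every $z\in C^*\setminus\{0\}$. Minimal set: $\mathcal{M}(U,C):=\{u\in U:\nexists\,u'\in U,\ u'\ne u,\ u'\preceq_C u\}$; $\omega(x):=|\mathcal{M}(H(x),C)|$, $[\omega(x)]=\{1,\dots,\omega(x)\}$.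 Partition set: enumerate $\mathcal{M}(H(x),C)=\{u_1^x,\dots,u_{\omega(x)}^x\}$ and, with $I_u(x):=\{j\in[p]:h^j(x)=u\}$, put $P_x:=\prod_{j=1}^{\omega(x)}I_{u_j^x}(x)$; elements are written $a=(a_1,\dots,a_{\omega(x)})$. For $x\in\mathrm{dom}(H)$, $$\Theta_l(x):=\min_{(a,v)\in P_x\times\mathbb{R}^n}\left\{\max_{j\in[\omega(x)]}\phi\left(\nabla f^{a_j}(x)^\top v+g^{a_j}(x+v)-g^{a_j}(x)\right)+\frac l2\|v\|^2\right\}$$ (the minimum is attained). Directional derivative: $D_vh(y):=\lim_{\alpha\to0^+}\frac1\alpha(h(y+\alpha v)-h(y))$ in the extended sense: $D_vh(y)\in-\mathrm{int}(C)$ means $\lim_{\alpha\to0^+}\frac1\alpha z^\top(h(y+\alpha v)-h(y))<0$ in $[-\infty,+\infty]$ for all $z\in C^*\setminus\{0\}$. A point $y\in\mathrm{dom}(H)$ is stationary if for every $a\in P_y$ and every $v\in\mathbb{R}^n$ there is $j\in[\omega(y)]$ with $D_vh^{a_j}(y)\notin-\mathrm{int}(C)$; otherwise non-stationary. Proximal gradient method without line search (stopping test disregarded): at iterate $x^k$ choose a minimizer $(a^l_k,v^k_l)\in P_{x^k}\times\mathbb{R}^n$ of the problem defining $\Theta_l(x^k)$ and set $x^{k+1}:=x^k+v^k_l$. *)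

theory Defs
  imports "HOL-Analysis.Analysis"
begin

text \<open>The space $W \cup \{+\infty_C\}$: a vector space with one additional top element.\<close>

datatype 'a topped = Fin 'a | TopC  (\<open>\<infinity>\<^sub>C\<close>)

instantiation topped :: (plus) plus
begin
fun plus_topped :: "'a topped \<Rightarrow> 'a topped \<Rightarrow> 'a topped" where
  "Fin w + Fin w' = Fin (w + w')"
| "\<infinity>\<^sub>C + _ = \<infinity>\<^sub>C"
| "_ + \<infinity>\<^sub>C = \<infinity>\<^sub>C"
instance ..
end

text \<open>Differences are only ever formed with a finite subtrahend (the base point lies in the
  domain); the last equation merely makes the operation total.\<close>

instantiation topped :: (minus) minus
begin
fun minus_topped :: "'a topped \<Rightarrow> 'a topped \<Rightarrow> 'a topped" where
  "Fin w - Fin w' = Fin (w - w')"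
| "\<infinity>\<^sub>C - Fin _ = \<infinity>\<^sub>C"
| "_ - \<infinity>\<^sub>C = \<infinity>\<^sub>C"
instance ..
end

text \<open>Multiples of \<open>\<infinity>\<^sub>C\<close> are needed in convex combinations with weights
  \<open>t\<close> and \<open>1 - t\<close>, \<open>0 < t \<le> 1\<close>. The weight \<open>0\<close> occurs only for \<open>t = 1\<close>, where the
  convexity inequality holds whether \<open>0 *\<^sub>R \<infinity>\<^sub>C\<close> is read as \<open>0\<close> or as \<open>\<infinity>\<^sub>C\<close>.\<close>

instantiation topped :: (scaleR) scaleR
begin
fun scaleR_topped :: "real \<Rightarrow> 'a topped \<Rightarrow> 'a topped" where
  "t *\<^sub>R Fin w = Fin (t *\<^sub>R w)"
| "t *\<^sub>R \<infinity>\<^sub>C = \<infinity>\<^sub>C"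
instance ..
end

fun cone_le :: "'a topped \<Rightarrow> 'a::euclidean_space set \<Rightarrow> 'a topped \<Rightarrow> bool"
    (\<open>(_/ \<preceq>\<^bsub>_\<^esub> _)\<close> [51, 0, 51] 50) where
  "Fin w \<preceq>\<^bsub>C\<^esub> Fin w' \<longleftrightarrow> w' - w \<in> C"
| "_ \<preceq>\<^bsub>C\<^esub> \<infinity>\<^sub>C \<longleftrightarrow> True"
| "\<infinity>\<^sub>C \<preceq>\<^bsub>C\<^esub> Fin _ \<longleftrightarrow> False"

fun cone_less :: "'a topped \<Rightarrow> 'a::euclidean_space set \<Rightarrow> 'a topped \<Rightarrow> bool"
    (\<open>(_/ \<prec>\<^bsub>_\<^esub> _)\<close> [51, 0, 51] 50) where
  "Fin w \<prec>\<^bsub>C\<^esub> Fin w' \<longleftrightarrow> w' - w \<in> interior C"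
| "Fin _ \<prec>\<^bsub>C\<^esub> \<infinity>\<^sub>C \<longleftrightarrow> True"
| "\<infinity>\<^sub>C \<prec>\<^bsub>C\<^esub> _ \<longleftrightarrow> False"

definition lower_set_le :: "'a topped set \<Rightarrow> 'a::euclidean_space set \<Rightarrow> 'a topped set \<Rightarrow> bool"
    (\<open>(_/ \<preceq>\<^sup>l\<^bsub>_\<^esub> _)\<close> [51, 0, 51] 50) where
  "U \<preceq>\<^sup>l\<^bsub>C\<^esub> V \<longleftrightarrow> (\<forall>v\<in>V. \<exists>u\<in>U. u \<preceq>\<^bsub>C\<^esub> v)"

definition pointed :: "'a::euclidean_space set \<Rightarrow> bool" where
  "pointed C \<longleftrightarrow> C \<inter> uminus ` C = {0}"

definition dual_cone :: "'a::euclidean_space set \<Rightarrow> 'a set" where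
  "dual_cone C = {z. \<forall>w\<in>C. 0 \<le> w \<bullet> z}"

text \<open>The scalar $z^\top w$ for \<open>z \<in> dual_cone C - {0}\<close> and an extended vector \<open>w\<close>.\<close>

fun pairing :: "'a::euclidean_space \<Rightarrow> 'a topped \<Rightarrow> ereal" where
  "pairing z (Fin w) = ereal (z \<bullet> w)"
| "pairing z \<infinity>\<^sub>C = \<infinity>"

fun phi :: "'a::euclidean_space set \<Rightarrow> 'a topped \<Rightarrow> ereal" where
  "phi C (Fin w) = (SUP z\<in>{z \<in> dual_cone C. norm z = 1}. ereal (z \<bullet> w))"
| "phi C \<infinity>\<^sub>C = \<infinity>"

definition cone_convex ::
    "'a::euclidean_space set \<Rightarrow> ('b::euclidean_space \<Rightarrow> 'a topped) \<Rightarrow> bool" where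
  "cone_convex C g \<longleftrightarrow> (\<forall>x y. \<forall>t\<in>{0<..1}.
     g (t *\<^sub>R x + (1 - t) *\<^sub>R y) \<preceq>\<^bsub>C\<^esub> t *\<^sub>R g x + (1 - t) *\<^sub>R g y)"

definition proper :: "('b \<Rightarrow> 'a topped) \<Rightarrow> bool" where
  "proper g \<longleftrightarrow> (\<exists>x. g x \<noteq> \<infinity>\<^sub>C)"

definition lower_semicont :: "('b::euclidean_space \<Rightarrow> ereal) \<Rightarrow> bool" where
  "lower_semicont F \<longleftrightarrow> (\<forall>x. F x \<le> Liminf (at x) F)"

definition cone_closed ::
    "'a::euclidean_space set \<Rightarrow> ('b::euclidean_space \<Rightarrow> 'a topped) \<Rightarrow> bool" where
  "cone_closed C g \<longleftrightarrow> (\<forall>z\<in>dual_cone C - {0}. lower_semicont (\<lambda>x. pairing z (g x)))"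

text \<open>\<open>nabla f x\<close> is the transposed Jacobian, with \<open>CARD('n)\<close> rows and \<open>CARD('m)\<close> columns.\<close>

definition nabla :: "(real^'n \<Rightarrow> real^'m) \<Rightarrow> real^'n \<Rightarrow> real^'m^'n" where
  "nabla f x = transpose (jacobian f (at x))"

definition continuously_differentiable :: "(real^'n \<Rightarrow> real^'m) \<Rightarrow> bool" where
  "continuously_differentiable f \<longleftrightarrow>
     f differentiable_on UNIV \<and> continuous_on UNIV (nabla f)"

text \<open>Lipschitz continuity of the gradient is with respect to the induced operator norm; the
  library's \<open>norm\<close> on matrices is the Frobenius norm, hence \<open>lipschitz_on\<close> is not used.\<close>

definition nabla_lipschitz :: "real \<Rightarrow> (real^'n \<Rightarrow> real^'m) \<Rightarrow> bool" where
  "nabla_lipschitz L f \<longleftrightarrow>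
     (\<forall>x y. onorm (\<lambda>w. (nabla f x - nabla f y) *v w) \<le> L * norm (x - y))"

definition hsum :: "(nat \<Rightarrow> 'b \<Rightarrow> 'a::plus) \<Rightarrow> (nat \<Rightarrow> 'b \<Rightarrow> 'a topped) \<Rightarrow> nat \<Rightarrow> 'b \<Rightarrow> 'a topped" where
  "hsum f g j x = Fin (f j x) + g j x"

definition Hmap :: "nat \<Rightarrow> (nat \<Rightarrow> 'b \<Rightarrow> 'a topped) \<Rightarrow> 'b \<Rightarrow> 'a topped set" where
  "Hmap p h x = (\<lambda>j. h j x) ` {1..p}"

definition dom_H ::
    "'a::euclidean_space set \<Rightarrow> nat \<Rightarrow> (nat \<Rightarrow> 'b \<Rightarrow> 'a topped) \<Rightarrow> 'b set" where
  "dom_H C p h = {x. \<forall>j\<in>{1..p}. h j x \<prec>\<^bsub>C\<^esub> \<infinity>\<^sub>C}"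

definition minimal_set :: "'a topped set \<Rightarrow> 'a::euclidean_space set \<Rightarrow> 'a topped set" where
  "minimal_set U C = {u \<in> U. \<not> (\<exists>u'\<in>U. u' \<noteq> u \<and> u' \<preceq>\<^bsub>C\<^esub> u)}"

definition omega ::
    "'a::euclidean_space set \<Rightarrow> nat \<Rightarrow> (nat \<Rightarrow> 'b \<Rightarrow> 'a topped) \<Rightarrow> 'b \<Rightarrow> nat" where
  "omega C p h x = card (minimal_set (Hmap p h x) C)"

text \<open>\<open>e x 1, \<dots>, e x (omega C p h x)\<close> enumerates the minimal elements of \<open>Hmap p h x\<close>
  without repetition. The enumeration is a parameter of all notions that depend on it.\<close>

definition minimal_enumeration ::
    "'a::euclidean_space set \<Rightarrow> nat \<Rightarrow> (nat \<Rightarrow> 'b \<Rightarrow> 'a topped) \<Rightarrow> ('b \<Rightarrow> nat \<Rightarrow> 'a topped) \<Rightarrow> bool" where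
  "minimal_enumeration C p h e \<longleftrightarrow>
     (\<forall>x\<in>dom_H C p h. bij_betw (e x) {1..omega C p h x} (minimal_set (Hmap p h x) C))"

definition active_indices ::
    "nat \<Rightarrow> (nat \<Rightarrow> 'b \<Rightarrow> 'a topped) \<Rightarrow> 'a topped \<Rightarrow> 'b \<Rightarrow> nat set" where
  "active_indices p h u x = {j \<in> {1..p}. h j x = u}"

definition partition_set ::
    "'a::euclidean_space set \<Rightarrow> nat \<Rightarrow> (nat \<Rightarrow> 'b \<Rightarrow> 'a topped) \<Rightarrow> ('b \<Rightarrow> nat \<Rightarrow> 'a topped) \<Rightarrow>
     'b \<Rightarrow> (nat \<Rightarrow> nat) set" where
  "partition_set C p h e x = (\<Pi>\<^sub>E j\<in>{1..omega C p h x}. active_indices p h (e x j) x)"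

definition prox_objective ::
    "(real^'m) set \<Rightarrow> nat \<Rightarrow> (nat \<Rightarrow> real^'n \<Rightarrow> real^'m) \<Rightarrow> (nat \<Rightarrow> real^'n \<Rightarrow> (real^'m) topped) \<Rightarrow>
     real \<Rightarrow> real^'n \<Rightarrow> (nat \<Rightarrow> nat) \<Rightarrow> real^'n \<Rightarrow> ereal" where
  "prox_objective C p f g l x a v =
     (MAX j\<in>{1..omega C p (hsum f g) x}.
        phi C (Fin (transpose (nabla (f (a j)) x) *v v) + g (a j) (x + v) - g (a j) x))
     + ereal (l / 2 * (norm v)\<^sup>2)"

definition prox_minimizer ::
    "(real^'m) set \<Rightarrow> nat \<Rightarrow> (nat \<Rightarrow> real^'n \<Rightarrow> real^'m) \<Rightarrow> (nat \<Rightarrow> real^'n \<Rightarrow> (real^'m) topped) \<Rightarrow>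
     (real^'n \<Rightarrow> nat \<Rightarrow> (real^'m) topped) \<Rightarrow> real \<Rightarrow> real^'n \<Rightarrow> (nat \<Rightarrow> nat) \<Rightarrow> real^'n \<Rightarrow> bool" where
  "prox_minimizer C p f g e l x a v \<longleftrightarrow>
     a \<in> partition_set C p (hsum f g) e x \<and>
     (\<forall>b\<in>partition_set C p (hsum f g) e x. \<forall>w.
        prox_objective C p f g l x a v \<le> prox_objective C p f g l x b w)"

text \<open>The minimum of the problem is expressed as an infimum in \<open>ereal\<close>; it equals the value of
  \<open>prox_objective\<close> at every \<open>prox_minimizer\<close>.\<close>

definition Theta ::
    "(real^'m) set \<Rightarrow> nat \<Rightarrow> (nat \<Rightarrow> real^'n \<Rightarrow> real^'m) \<Rightarrow> (nat \<Rightarrow> real^'n \<Rightarrow> (real^'m) topped) \<Rightarrow>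
     (real^'n \<Rightarrow> nat \<Rightarrow> (real^'m) topped) \<Rightarrow> real \<Rightarrow> real^'n \<Rightarrow> ereal" where
  "Theta C p f g e l x =
     (INF (a, v)\<in>partition_set C p (hsum f g) e x \<times> UNIV. prox_objective C p f g l x a v)"

text \<open>The assertion $D_v h(y) \in -\mathrm{int}(C)$ in the extended sense, for \<open>h y\<close> finite.\<close>

definition dir_deriv_in_neg_interior ::
    "'a::euclidean_space set \<Rightarrow> ('b::euclidean_space \<Rightarrow> 'a topped) \<Rightarrow> 'b \<Rightarrow> 'b \<Rightarrow> bool" where
  "dir_deriv_in_neg_interior C h y v \<longleftrightarrow>
     (\<forall>z\<in>dual_cone C - {0}. \<exists>d<0.
        ((\<lambda>\<alpha>. ereal (1 / \<alpha>) * pairing z (h (y + \<alpha> *\<^sub>R v) - h y)) \<longlongrightarrow> d) (at_right 0))"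

definition stationary ::
    "'a::euclidean_space set \<Rightarrow> nat \<Rightarrow> (nat \<Rightarrow> 'b::euclidean_space \<Rightarrow> 'a topped) \<Rightarrow>
     ('b \<Rightarrow> nat \<Rightarrow> 'a topped) \<Rightarrow> 'b \<Rightarrow> bool" where
  "stationary C p h e y \<longleftrightarrow> y \<in> dom_H C p h \<and>
     (\<forall>a\<in>partition_set C p h e y. \<forall>v. \<exists>j\<in>{1..omega C p h y}.
        \<not> dir_deriv_in_neg_interior C (h (a j)) y v)"

end

theory Submission
  imports Defs
begin

text \<open>The minimum value \<open>\<theta>\<^sub>k\<close> of the subproblem at \<open>x k\<close> is at most \<open>0\<close> (take \<open>v = 0\<close>), and by the
  descent lemma $z^\top(h^{a_j}(x^{k+1}) - h^{a_j}(x^k)) \le \theta_k$ for all unit vectors \<open>z\<close> of the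
  dual cone. For a fixed \<open>c \<in> interior C\<close> of norm at most \<open>1\<close> the bipolar theorem turns this into
  $h^{a_j}(x^{k+1}) \preceq_C h^{a_j}(x^k) + \theta_k c$. Every element of \<open>H (x k)\<close> lies above a minimal
  one, so $H(x^{k+1}) \preceq^\ell H(x^k) + \theta_k c$, and these relations can be chained even though
  the active indices change from step to step. A bounded set below all \<open>H (x k)\<close> therefore bounds the
  series of the \<open>\<bar>\<theta>\<^sub>k\<bar>\<close>.\<close>

section \<open>Cones and the induced order\<close>

lemma cone_add:
  assumes "convex C" "cone C" "a \<in> C" "b \<in> C"
  shows "a + b \<in> C"
  using assms convex_cone by blast

lemma cone_zero_mem:
  assumes "cone C" "interior C \<noteq> {}"
  shows "0 \<in> C"
  using assms cone_contains_0 interior_empty by blast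

lemma cone_le_refl:
  assumes "0 \<in> C"
  shows "u \<preceq>\<^bsub>C\<^esub> u"
  using assms by (cases u) auto

lemma cone_le_trans:
  assumes "convex C" "cone C" "u \<preceq>\<^bsub>C\<^esub> v" "v \<preceq>\<^bsub>C\<^esub> w"
  shows "u \<preceq>\<^bsub>C\<^esub> w"
proof (cases u; cases v; cases w)
  fix u' v' w' assume "u = Fin u'" "v = Fin v'" "w = Fin w'"
  then show ?thesis
    using assms cone_add[OF assms(1,2), of "v' - u'" "w' - v'"] by simp
qed (use assms(3,4) in simp_all)

lemma cone_le_antisym:
  assumes "pointed C" "u \<preceq>\<^bsub>C\<^esub> v" "v \<preceq>\<^bsub>C\<^esub> u"
  shows "u = v"
proof (cases u; cases v)
  fix u' v' assume uv: "u = Fin u'" "v = Fin v'"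
  then have "v' - u' \<in> C" "u' - v' \<in> C"
    using assms by auto
  then have "v' - u' \<in> C \<inter> uminus ` C"
    by (auto simp: image_iff intro: bexI[of _ "u' - v'"])
  then have "v' - u' = 0"
    using assms(1) unfolding pointed_def by blast
  then show ?thesis
    using uv by simp
qed (use assms(2,3) in simp_all)

text \<open>The strict part of the order is asymmetric and transitive, so among the finitely many
  elements of \<open>U\<close> below \<open>u\<close> there is a minimal one. By transitivity,
  anything below it is again below \<open>u\<close>, hence it is minimal in all of
  \<open>U\<close>.\<close>

lemma minimal_set_below:
  assumes "convex C" "cone C" "pointed C" "0 \<in> C" and U: "finite U" "u \<in> U"
  obtains m where "m \<in> minimal_set U C" "m \<preceq>\<^bsub>C\<^esub> u"
proof -
  let ?R = "\<lambda>y z. y \<preceq>\<^bsub>C\<^esub> z \<and> y \<noteq> z"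
  have "asymp_on U ?R"
    using cone_le_antisym[OF assms(3)] by (auto intro!: asymp_onI)
  moreover have "transp_on U ?R"
    using cone_le_antisym[OF assms(3)] cone_le_trans[OF assms(1,2)]
    by (intro transp_onI) blast
  moreover have "\<exists>y\<in>U. y \<preceq>\<^bsub>C\<^esub> u"
    using U cone_le_refl[OF assms(4)] by blast
  ultimately have "\<exists>m\<in>U. m \<preceq>\<^bsub>C\<^esub> u \<and> (\<forall>y\<in>U. ?R y m \<longrightarrow> \<not> y \<preceq>\<^bsub>C\<^esub> u)"
    by (rule Finite_Set.bex_min_element_with_property[OF U(1)])
  then obtain m where m: "m \<in> U" "m \<preceq>\<^bsub>C\<^esub> u"
      "\<And>y. y \<in> U \<Longrightarrow> ?R y m \<Longrightarrow> \<not> y \<preceq>\<^bsub>C\<^esub> u"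
    by blast
  then have "m \<in> minimal_set U C"
    using cone_le_trans[OF assms(1,2)] by (fastforce simp: minimal_set_def)
  then show thesis
    using m that by blast
qed

section \<open>Separation and the dual cone\<close>

lemma dual_separation:
  assumes "closed C" "convex C" "cone C" "0 \<in> C" "w \<notin> C"
  obtains z where "z \<in> dual_cone C" "w \<bullet> z < 0"
proof -
  obtain z b where z: "z \<bullet> w < b" "\<And>y. y \<in> C \<Longrightarrow> b < z \<bullet> y"
    using separating_hyperplane_closed_point[OF assms(2,1,5)] by blast
  have "b < 0"
    using z(2)[OF assms(4)] by simp
  have "0 \<le> y \<bullet> z" if "y \<in> C" for y
  proof (rule ccontr)
    assume "\<not> 0 \<le> y \<bullet> z"
    then have neg: "z \<bullet> y < 0"
      by (simp add: inner_commute)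
    \<comment> \<open>The positive factor is chosen so that the pairing with \<open>z\<close>
      becomes exactly \<open>b\<close>, against the strict bound on \<open>C\<close>.\<close>
    then have "(b / (z \<bullet> y)) *\<^sub>R y \<in> C"
      using assms(3) that \<open>b < 0\<close> by (intro mem_cone) (auto simp: divide_nonpos_neg)
    from z(2)[OF this] neg show False
      by simp
  qed
  then show thesis
    using that[of z] z(1) \<open>b < 0\<close> by (simp add: dual_cone_def inner_commute)
qed

lemma dual_cone_scaleR:
  assumes "z \<in> dual_cone C" "0 \<le> t"
  shows "t *\<^sub>R z \<in> dual_cone C"
  using assms by (auto simp: dual_cone_def)

lemma dual_cone_normalize:
  assumes "z \<in> dual_cone C" "z \<noteq> 0"
  shows "z /\<^sub>R norm z \<in> {z \<in> dual_cone C. norm z = 1}"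
  using assms by (simp add: dual_cone_scaleR)

text \<open>Bipolar theorem for unit vectors, the ones over which \<open>phi\<close> takes its
  supremum: a separating functional is nonzero and can be normalized.\<close>

lemma mem_cone_if_unit_dual_nonneg:
  assumes "closed C" "convex C" "cone C" "0 \<in> C"
    and nonneg: "\<And>z. z \<in> dual_cone C \<Longrightarrow> norm z = 1 \<Longrightarrow> 0 \<le> w \<bullet> z"
  shows "w \<in> C"
proof (rule ccontr)
  assume "w \<notin> C"
  then obtain z where z: "z \<in> dual_cone C" "w \<bullet> z < 0"
    using dual_separation[OF assms(1-4)] by blast
  then have "z \<noteq> 0"
    by auto
  then have "0 \<le> w \<bullet> (z /\<^sub>R norm z)"
    using dual_cone_normalize[OF z(1)] nonneg by blast
  then show False
    using z(2) \<open>z \<noteq> 0\<close> by (simp add: zero_le_mult_iff)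
qed

text \<open>Pointedness keeps \<open>C\<close> from being the whole space, which would contain
  \<open>b\<close> and \<open>- b\<close>. Without unit dual vectors, the membership criterion would
  hold vacuously for a \<open>w\<close> outside \<open>C\<close>.\<close>

lemma unit_dual_nonempty:
  fixes C :: "'a::euclidean_space set"
  assumes "closed C" "convex C" "cone C" "pointed C" "0 \<in> C"
  obtains z where "z \<in> dual_cone C" "norm z = 1"
proof -
  obtain b :: 'a where b: "b \<in> Basis"
    using nonempty_Basis by blast
  have "b \<notin> C \<or> - b \<notin> C"
  proof (rule ccontr)
    assume "\<not> (b \<notin> C \<or> - b \<notin> C)"
    then have "b \<in> C \<inter> uminus ` C"
      by (auto simp: image_iff intro: bexI[of _ "- b"])
    then have "b = 0"
      using assms(4) unfolding pointed_def by blast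
    then show False
      using b by simp
  qed
  then obtain w where "w \<notin> C"
    by blast
  then show thesis
    using mem_cone_if_unit_dual_nonneg[OF assms(1-3,5), of w] that by blast
qed

text \<open>A step of length \<epsilon> from \<open>c\<close> against \<open>z\<close> stays in
  \<open>C\<close> and lowers the pairing by \<open>\<epsilon> * norm z\<close>, so the pairing at
  \<open>c\<close> is at least that large.\<close>

lemma interior_dual_pos:
  assumes "c \<in> interior C" "z \<in> dual_cone C" "z \<noteq> 0"
  shows "0 < c \<bullet> z"
proof -
  obtain \<epsilon> where \<epsilon>: "\<epsilon> > 0" "cball c \<epsilon> \<subseteq> C"
    using assms(1) by (meson mem_interior_cball)
  have "c - (\<epsilon> / norm z) *\<^sub>R z \<in> cball c \<epsilon>"
    using \<epsilon>(1) assms(3) by (simp add: dist_norm)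
  then have "0 \<le> (c - (\<epsilon> / norm z) *\<^sub>R z) \<bullet> z"
    using \<epsilon>(2) assms(2) unfolding dual_cone_def by blast
  then have "\<epsilon> * norm z \<le> c \<bullet> z"
    using assms(3) by (simp add: inner_diff_left dot_square_norm power2_eq_square)
  moreover have "0 < \<epsilon> * norm z"
    using \<epsilon>(1) assms(3) by simp
  ultimately show ?thesis
    by linarith
qed

text \<open>The interior is stable under positive scaling. The norm bound gives
  \<open>c \<bullet> z \<le> 1\<close> for unit \<open>z\<close>, which later converts scalar
  decreases into multiples of \<open>c\<close>.\<close>

lemma interior_cone_unit_bound:
  fixes C :: "'a::euclidean_space set"
  assumes "cone C" "interior C \<noteq> {}"
  obtains c where "c \<in> interior C" "norm c \<le> 1"
proof -
  obtain w where w: "w \<in> interior C"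
    using assms(2) by blast
  \<comment> \<open>The summand 1 makes the factor positive even for \<open>w = 0\<close>.\<close>
  define t where "t = 1 / (1 + norm w)"
  have t: "t > 0"
    by (simp add: t_def add_pos_nonneg)
  have "(*\<^sub>R) t ` C \<subseteq> C"
    using assms(1) t by (auto simp: cone_def)
  then have "(*\<^sub>R) t ` interior C \<subseteq> interior C"
    using open_scaling[of t "interior C"] t interior_subset[of C]
    by (intro interior_maximal) auto
  then have "t *\<^sub>R w \<in> interior C"
    using w by blast
  moreover have "norm (t *\<^sub>R w) \<le> 1"
    by (simp add: t_def divide_le_eq add_pos_nonneg)
  ultimately show thesis
    using that by blast
qed

section \<open>Values of the scalarization \<open>phi\<close>\<close>

lemma phi_zero:
  assumes "z \<in> dual_cone C" "norm z = 1"
  shows "phi C (Fin 0) = 0"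
  \<comment> \<open>The vector \<open>z\<close> matters here: in \<open>ereal\<close> a supremum
    over the empty set would be minus infinity.\<close>
  using assms by (auto simp: zero_ereal_def intro!: cSUP_const)

lemma inner_le_phi:
  assumes "z \<in> dual_cone C" "norm z = 1"
  shows "ereal (z \<bullet> w) \<le> phi C (Fin w)"
  using assms by (auto intro: SUP_upper)

lemma phi_Fin_finite: "phi C (Fin w) \<noteq> \<infinity>"
proof -
  have "phi C (Fin w) \<le> ereal (norm w)"
    by (auto intro!: SUP_least) (metis mult_1 norm_cauchy_schwarz)
  then show ?thesis
    by auto
qed

section \<open>The descent inequality\<close>

lemma nabla_has_derivative:
  fixes f :: "real^'n \<Rightarrow> real^'m"
  assumes "continuously_differentiable f"
  shows "(f has_derivative (\<lambda>v. transpose (nabla f x) *v v)) (at x)"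
  using assms
  by (metis continuously_differentiable_def differentiable_on_eq_differentiable_at
      iso_tuple_UNIV_I jacobian_works nabla_def open_UNIV transpose_transpose)

text \<open>Pairing with \<open>z\<close> and restricting to the line through \<open>x\<close> in
  direction \<open>v\<close> makes the descent lemma one-dimensional. Monotonicity of \<psi> for
  \<open>t \<ge> 0\<close> takes the place of integrating the derivative.\<close>

lemma nabla_descent:
  fixes f :: "real^'n \<Rightarrow> real^'m"
  assumes f: "continuously_differentiable f" and lip: "nabla_lipschitz L f" and z: "norm z = 1"
  shows "z \<bullet> (f (x + v) - f x) \<le> z \<bullet> (transpose (nabla f x) *v v) + L / 2 * (norm v)\<^sup>2"
proof -
  define D where "D y = z \<bullet> (transpose (nabla f y) *v v)" for y
  define \<psi> where "\<psi> t = z \<bullet> f (x + t *\<^sub>R v) - t * D x - L / 2 * (norm v)\<^sup>2 * t\<^sup>2" for t :: real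
  have deriv: "(\<psi> has_real_derivative D (x + t *\<^sub>R v) - D x - L * (norm v)\<^sup>2 * t) (at t)" for t
  proof -
    have line: "((\<lambda>t. x + t *\<^sub>R v) has_derivative (\<lambda>s. s *\<^sub>R v)) (at t)"
      by (auto intro!: derivative_eq_intros)
    have "((\<lambda>t. z \<bullet> f (x + t *\<^sub>R v)) has_derivative
        (\<lambda>s. z \<bullet> (transpose (nabla f (x + t *\<^sub>R v)) *v (s *\<^sub>R v)))) (at t)"
      by (intro has_derivative_inner_right has_derivative_compose[OF line nabla_has_derivative[OF f]])
    then have "((\<lambda>t. z \<bullet> f (x + t *\<^sub>R v)) has_real_derivative D (x + t *\<^sub>R v)) (at t)"
      by (rule has_derivative_imp_has_field_derivative)
        (simp add: D_def matrix_vector_mult_scaleR del: transpose_matrix_vector)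
    then show ?thesis
      unfolding \<psi>_def by (auto intro!: derivative_eq_intros)
  qed
  have slope: "D (x + t *\<^sub>R v) - D x \<le> L * (norm v)\<^sup>2 * t" if "0 \<le> t" for t
  proof -
    let ?A = "nabla f (x + t *\<^sub>R v) - nabla f x"
    \<comment> \<open>The transpose is moved over to \<open>z\<close>, so that the operator norm of
      the untransposed difference appears, as in \<open>nabla_lipschitz\<close>.\<close>
    have "D (x + t *\<^sub>R v) - D x = (?A *v z) \<bullet> v"
      by (simp add: D_def inner_commute[of z] inner_commute[of _ v] dot_lmul_matrix
          matrix_vector_mult_diff_rdistrib inner_diff_right)
    also have "\<dots> \<le> norm (?A *v z) * norm v"
      by (rule norm_cauchy_schwarz)
    also have "norm (?A *v z) \<le> onorm ((*v) ?A) * norm z"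
      by (rule onorm) (rule matrix_vector_mul_bounded_linear)
    also have "\<dots> \<le> L * (t * norm v)"
      using lip[unfolded nabla_lipschitz_def, rule_format, of "x + t *\<^sub>R v" x] that z by simp
    finally show ?thesis
      by (simp add: power2_eq_square mult_ac mult_right_mono)
  qed
  have "\<psi> 1 \<le> \<psi> 0"
    by (rule DERIV_nonpos_imp_nonincreasing) (use deriv slope in \<open>auto simp: algebra_simps intro!: exI\<close>)
  then show ?thesis
    by (simp add: \<psi>_def D_def inner_diff_right)
qed

section \<open>One step of the proximal gradient method\<close>

lemma Theta_eq_prox_objective:
  assumes "prox_minimizer C p f g e l x a v"
  shows "Theta C p f g e l x = prox_objective C p f g l x a v"
  unfolding Theta_def using assms
  by (intro antisym INF_lower2[of "(a, v)"] INF_greatest) (auto simp: prox_minimizer_def)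

lemma dom_H_iff: "x \<in> dom_H C p h \<longleftrightarrow> (\<forall>j\<in>{1..p}. \<exists>r. h j x = Fin r)"
proof -
  have "w \<prec>\<^bsub>C\<^esub> \<infinity>\<^sub>C \<longleftrightarrow> (\<exists>r. w = Fin r)" for w
    by (cases w) auto
  then show ?thesis
    by (simp add: dom_H_def)
qed

lemma hsum_eq_Fin_iff:
  fixes f :: "nat \<Rightarrow> 'b \<Rightarrow> 'a::ab_group_add"
  shows "hsum f g j x = Fin r \<longleftrightarrow> g j x = Fin (r - f j x)"
  by (cases "g j x") (auto simp: hsum_def algebra_simps)

lemma partition_setD:
  assumes "minimal_enumeration C p h e" "x \<in> dom_H C p h" "a \<in> partition_set C p h e x"
    "j \<in> {1..omega C p h x}"
  shows "a j \<in> {1..p}" "h (a j) x = e x j"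
  using assms by (auto simp: partition_set_def active_indices_def PiE_iff)

text \<open>Ensures that the maximum in \<open>prox_objective\<close> runs over a nonempty index
  set, since \<open>Max\<close> of the empty set is unspecified.\<close>

lemma omega_pos:
  assumes "convex C" "cone C" "pointed C" "0 \<in> C" "1 \<le> p"
  shows "0 < omega C p h x"
proof -
  have fin: "finite (Hmap p h x)" and "h 1 x \<in> Hmap p h x"
    using assms(5) by (auto simp: Hmap_def)
  then obtain m where "m \<in> minimal_set (Hmap p h x) C"
    using minimal_set_below[OF assms(1-4)] by metis
  moreover have "finite (minimal_set (Hmap p h x) C)"
    using fin by (simp add: minimal_set_def)
  ultimately show ?thesis
    by (auto simp: omega_def card_gt_0_iff)
qed

lemma Theta_nonpos_finite:
  fixes C :: "(real^'m) set" and x v :: "real^'n"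
  assumes C: "closed C" "convex C" "cone C" "pointed C" "0 \<in> C" and p: "1 \<le> p"
    and e: "minimal_enumeration C p (hsum f g) e"
    and dom: "x \<in> dom_H C p (hsum f g)" "x + v \<in> dom_H C p (hsum f g)"
    and min: "prox_minimizer C p f g e l x a v"
  obtains \<theta> where "Theta C p f g e l x = ereal \<theta>" "\<theta> \<le> 0"
proof -
  obtain z where z: "z \<in> dual_cone C" "norm z = 1"
    using unit_dual_nonempty[OF C] by blast
  define J where "J = {1..omega C p (hsum f g) x}"
  have J: "finite J" "J \<noteq> {}"
    using omega_pos[OF C(2-5) p, of "hsum f g" x] by (auto simp: J_def)
  have a: "a \<in> partition_set C p (hsum f g) e x"
    using min by (simp add: prox_minimizer_def)
  have fin: "\<exists>r. g (a j) x = Fin r" "\<exists>r. g (a j) (x + v) = Fin r" if "j \<in> J" for j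
    using partition_setD(1)[OF e dom(1) a] that dom unfolding J_def dom_H_iff hsum_eq_Fin_iff
    by blast+
  let ?w = "\<lambda>u j. Fin (transpose (nabla (f (a j)) x) *v u) + g (a j) (x + u) - g (a j) x"
  have "phi C (?w 0 j) = 0" if "j \<in> J" for j
    using fin(1)[OF that] phi_zero[OF z] by (auto simp del: phi.simps)
  then have zero: "(\<lambda>j. phi C (?w 0 j)) ` J = {0}"
    using J by force
  \<comment> \<open>The competitor keeps the index tuple \<open>a\<close> and takes the zero
    displacement.\<close>
  have "prox_objective C p f g l x a 0 = 0"
    unfolding prox_objective_def J_def[symmetric] zero by simp
  then have nonpos: "prox_objective C p f g l x a v \<le> 0"
    using min a unfolding prox_minimizer_def by metis
  define M where "M = (MAX j\<in>J. phi C (?w v j))"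
  \<comment> \<open>The maximum is attained at some index. Its argument is finite because
    \<open>x + v\<close> lies in the domain, and so \<open>phi\<close> is real there.\<close>
  have "M \<in> (\<lambda>j. phi C (?w v j)) ` J"
    unfolding M_def using J by (intro Max_in) auto
  then obtain j where j: "j \<in> J" "M = phi C (?w v j)"
    by blast
  obtain w where w: "?w v j = Fin w"
    using fin[OF j(1)] by auto
  have "ereal (z \<bullet> w) \<le> M"
    using inner_le_phi[OF z, of w] by (simp only: j(2) w)
  moreover have "M \<noteq> \<infinity>"
    using phi_Fin_finite by (simp only: j(2) w) blast
  ultimately obtain m where "M = ereal m"
    by (cases M) auto
  then have "prox_objective C p f g l x a v = ereal (m + l / 2 * (norm v)\<^sup>2)"
    unfolding prox_objective_def J_def[symmetric] M_def[symmetric] by simp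
  then show thesis
    using that[of "m + l / 2 * (norm v)\<^sup>2"] Theta_eq_prox_objective[OF min] nonpos by simp
qed

text \<open>Stated for every element of \<open>Hmap p (hsum f g) x\<close>, minimal or not, so that
  the resulting element at \<open>x + v\<close> can serve as input for the next step.\<close>

lemma prox_step_decrease:
  fixes C :: "(real^'m) set" and x v :: "real^'n"
  assumes C: "closed C" "convex C" "cone C" "pointed C" "0 \<in> C"
    and e: "minimal_enumeration C p (hsum f g) e"
    and dom: "x \<in> dom_H C p (hsum f g)" "x + v \<in> dom_H C p (hsum f g)"
    and f: "\<And>j. j \<in> {1..p} \<Longrightarrow> continuously_differentiable (f j)"
    and lip: "\<And>j. j \<in> {1..p} \<Longrightarrow> nabla_lipschitz (Lc j) (f j)"
    and l: "\<And>j. j \<in> {1..p} \<Longrightarrow> Lc j \<le> l"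
    and min: "prox_minimizer C p f g e l x a v"
    and \<theta>: "Theta C p f g e l x = ereal \<theta>" "\<theta> \<le> 0"
    and c: "norm c \<le> 1"
    and u: "Fin u \<in> Hmap p (hsum f g) x"
  obtains u' where "Fin u' \<in> Hmap p (hsum f g) (x + v)" "u + \<theta> *\<^sub>R c - u' \<in> C"
proof -
  define J where "J = {1..omega C p (hsum f g) x}"
  \<comment> \<open>Only minimal values are represented by \<open>a\<close>, so the argument first
    descends from \<open>u\<close> to such a value and uses its index.\<close>
  obtain m where m: "m \<in> minimal_set (Hmap p (hsum f g) x) C" "m \<preceq>\<^bsub>C\<^esub> Fin u"
    using minimal_set_below[OF C(2-5) _ u] by (auto simp: Hmap_def)
  then obtain j where j: "j \<in> J" "m = e x j"
    using e dom(1) unfolding minimal_enumeration_def J_def bij_betw_def by blast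
  have a: "a \<in> partition_set C p (hsum f g) e x"
    using min by (simp add: prox_minimizer_def)
  define i where "i = a j"
  have i: "i \<in> {1..p}" "hsum f g i x = m"
    using partition_setD[OF e dom(1) a] j unfolding J_def i_def by auto
  obtain r r' where r: "hsum f g i x = Fin r" "hsum f g i (x + v) = Fin r'"
    using dom i(1) unfolding dom_H_iff by blast
  \<comment> \<open>This is the argument of \<open>phi\<close> at index \<open>i\<close>, with each
    value of \<open>g i\<close> written as the value of the sum minus that of
    \<open>f i\<close>.\<close>
  define w where "w = transpose (nabla (f i) x) *v v + (r' - f i (x + v)) - (r - f i x)"
  have w: "Fin (transpose (nabla (f i) x) *v v) + g i (x + v) - g i x = Fin w"
    using r by (simp add: hsum_eq_Fin_iff w_def)
  have "0 \<le> (r + \<theta> *\<^sub>R c - r') \<bullet> z" if z: "z \<in> dual_cone C" "norm z = 1" for z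
  proof -
    have "ereal (z \<bullet> w) \<le> phi C (Fin w)"
      by (rule inner_le_phi[OF z])
    also have "\<dots> \<le> (MAX j\<in>J. phi C (Fin (transpose (nabla (f (a j)) x) *v v) + g (a j) (x + v) - g (a j) x))"
      using j(1) by (intro Max_ge) (auto simp: J_def w[symmetric] i_def simp del: phi.simps intro!: image_eqI[of _ _ j])
    finally have "ereal (z \<bullet> w) + ereal (l / 2 * (norm v)\<^sup>2) \<le> ereal \<theta>"
      unfolding \<theta>(1)[symmetric] Theta_eq_prox_objective[OF min] prox_objective_def J_def
      by (rule add_right_mono)
    then have "z \<bullet> w + l / 2 * (norm v)\<^sup>2 \<le> \<theta>"
      by simp
    moreover have "z \<bullet> (f i (x + v) - f i x) \<le> z \<bullet> (transpose (nabla (f i) x) *v v) + Lc i / 2 * (norm v)\<^sup>2"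
      by (rule nabla_descent[OF f lip z(2)]) (use i in auto)
    \<comment> \<open>The quadratic error of the descent lemma is absorbed by the proximal term,
      which is where \<open>Lc i \<le> l\<close> enters.\<close>
    moreover have "Lc i / 2 * (norm v)\<^sup>2 \<le> l / 2 * (norm v)\<^sup>2"
      using l[OF i(1)] by (intro mult_right_mono) auto
    ultimately have "z \<bullet> (r' - r) \<le> \<theta>"
      unfolding w_def inner_add_right inner_diff_right by linarith
    moreover have "c \<bullet> z \<le> 1"
      using norm_cauchy_schwarz[of c z] c z(2) by simp
    \<comment> \<open>Multiplying \<open>c \<bullet> z \<le> 1\<close> by the nonpositive \<theta>
      reverses the inequality; this bounds the decrease by one in direction \<open>c\<close>,
      uniformly in \<open>z\<close>.\<close>
    then have "\<theta> \<le> \<theta> * (c \<bullet> z)"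
      using \<theta>(2) mult_left_mono_neg[of "c \<bullet> z" 1 \<theta>] by simp
    ultimately show ?thesis
      by (simp add: inner_add_left inner_diff_left inner_diff_right inner_commute[of z])
  qed
  then have "r + \<theta> *\<^sub>R c - r' \<in> C"
    by (rule mem_cone_if_unit_dual_nonneg[OF C(1-3,5)])
  moreover have "u - r \<in> C"
    using m(2) i(2) r(1) by auto
  ultimately have "u - r + (r + \<theta> *\<^sub>R c - r') \<in> C"
    by (intro cone_add[OF C(2,3)])
  then have "u + \<theta> *\<^sub>R c - r' \<in> C"
    by (simp add: algebra_simps)
  moreover have "Fin r' \<in> Hmap p (hsum f g) (x + v)"
    using i(1) r(2) unfolding Hmap_def by force
  ultimately show thesis
    using that by blast
qed

section \<open>Summing the decreases along the iterates\<close>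

theorem theorem5p4:
  fixes C :: "(real^'m) set"
    and p :: nat
    and f :: "nat \<Rightarrow> real^'n \<Rightarrow> real^'m"
    and g :: "nat \<Rightarrow> real^'n \<Rightarrow> (real^'m) topped"
    and h :: "nat \<Rightarrow> real^'n \<Rightarrow> (real^'m) topped"
    and H :: "real^'n \<Rightarrow> (real^'m) topped set"
    and e :: "real^'n \<Rightarrow> nat \<Rightarrow> (real^'m) topped"
    and Lc :: "nat \<Rightarrow> real" and L l :: real
    and x0 :: "real^'n" and \<L> :: "(real^'n) set"
    and x v :: "nat \<Rightarrow> real^'n"
    and a :: "nat \<Rightarrow> nat \<Rightarrow> nat"
  assumes C: "closed C" "convex C" "cone C" "pointed C" "interior C \<noteq> {}"
    and p: "1 \<le> p"
    and h_def: "h = hsum f g"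
    and H_def: "H = Hmap p h"
    and f_C1: "\<And>j. j \<in> {1..p} \<Longrightarrow> continuously_differentiable (f j)"
    and g: "\<And>j. j \<in> {1..p} \<Longrightarrow> proper (g j) \<and> cone_closed C (g j) \<and> cone_convex C (g j)"
    and e: "minimal_enumeration C p h e"
    and x0_dom: "x0 \<in> dom_H C p h"
    and \<L>_def: "\<L> = {y. H y \<preceq>\<^sup>l\<^bsub>C\<^esub> H x0}"
    and chains_bounded: "\<And>S :: nat \<Rightarrow> (real^'m) topped set.
          (\<And>k. S k \<in> H ` \<L>) \<Longrightarrow> (\<And>k. S (Suc k) \<preceq>\<^sup>l\<^bsub>C\<^esub> S k) \<Longrightarrow>
          \<exists>T :: (real^'m) set. bounded T \<and> (\<forall>k. Fin ` T \<preceq>\<^sup>l\<^bsub>C\<^esub> S k)"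
    and f_lipschitz: "\<And>j. j \<in> {1..p} \<Longrightarrow> nabla_lipschitz (Lc j) (f j)"
    and L_def: "L = Max (Lc ` {1..p})"
    and l: "L \<le> l" "0 < l"
    and x_init: "x 0 = x0"
    and x_dom: "\<And>k. x k \<in> dom_H C p h"
    and x_nonstationary: "\<And>k. \<not> stationary C p h e (x k)"
    and minimizer: "\<And>k. prox_minimizer C p f g e l (x k) (a k) (v k)"
    and x_step: "\<And>k. x (Suc k) = x k + v k"
  shows "\<exists>C2::real > 0. \<forall>K::nat. 1 \<le> K \<longrightarrow>
           (\<exists>k\<in>{0..K}. \<bar>Theta C p f g e l (x k)\<bar> < ereal (C2 / real K))"
proof -
  note cone = C(1-4) cone_zero_mem[OF C(3,5)]
  have "\<exists>\<theta>. Theta C p f g e l (x k) = ereal \<theta> \<and> \<theta> \<le> 0" for k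
    using Theta_nonpos_finite[OF cone p _ _ _ minimizer] e x_dom[of k] x_dom[of "Suc k"] x_step[of k]
    by (metis h_def)
  then obtain \<theta> where \<theta>: "\<And>k. Theta C p f g e l (x k) = ereal (\<theta> k)" "\<And>k. \<theta> k \<le> 0"
    by metis
  obtain c where c: "c \<in> interior C" "norm c \<le> 1"
    using interior_cone_unit_bound[OF C(3,5)] by blast
  have Lc_le: "Lc j \<le> l" if "j \<in> {1..p}" for j
    using Max_ge[of "Lc ` {1..p}" "Lc j"] that l(1) unfolding L_def by auto
  have step: "\<exists>u'. Fin u' \<in> H (x (Suc k)) \<and> u + \<theta> k *\<^sub>R c - u' \<in> C" if "Fin u \<in> H (x k)" for k u
    using prox_step_decrease[OF cone e[unfolded h_def] x_dom[of k, unfolded h_def] _ f_C1 f_lipschitz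
        Lc_le minimizer[of k] \<theta>(1)[of k] \<theta>(2)[of k] c(2), of u]
      x_dom[of "Suc k"] that unfolding x_step[symmetric] H_def h_def by metis
  \<comment> \<open>One element of \<open>H (x 0)\<close> is followed through all steps while the
    decreases accumulate; the index attaining \<open>u'\<close> may differ for every
    \<open>k\<close>.\<close>
  have chain: "\<exists>u'. Fin u' \<in> H (x k) \<and> u + (\<Sum>i<k. \<theta> i) *\<^sub>R c - u' \<in> C" if "Fin u \<in> H (x 0)" for k u
  proof (induction k)
    case 0
    then show ?case
      using that cone(5) by auto
  next
    case (Suc k)
    then obtain u' u'' where u': "u + (\<Sum>i<k. \<theta> i) *\<^sub>R c - u' \<in> C"
      and u'': "Fin u'' \<in> H (x (Suc k))" "u' + \<theta> k *\<^sub>R c - u'' \<in> C"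
      using step by blast
    from cone_add[OF C(2,3) u' u''(2)] show ?case
      using u''(1) by (auto simp: algebra_simps)
  qed
  have H_elem: "\<exists>r. u = Fin r" if "u \<in> H (x k)" for u k
    using that x_dom[of k] by (auto simp: H_def Hmap_def dom_H_iff)
  have "c \<in> C"
    using c(1) interior_subset by blast
  \<comment> \<open>Forgetting a decrease amounts to adding \<open>(- t) *\<^sub>R c\<close>, which
    lies in \<open>C\<close>.\<close>
  have drop: "u - u' \<in> C" if "u + t *\<^sub>R c - u' \<in> C" "t \<le> 0" for u u' t
    using cone_add[OF C(2,3) that(1) mem_cone[OF C(3) \<open>c \<in> C\<close>, of "- t"]] that(2) by simp
  have below: "H (x k) \<preceq>\<^sup>l\<^bsub>C\<^esub> H (x 0)" for k
    unfolding lower_set_le_def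
  proof
    fix u assume u: "u \<in> H (x 0)"
    then obtain r where "u = Fin r"
      using H_elem by blast
    with chain[of r k] u obtain u' where "Fin u' \<in> H (x k)" "r + (\<Sum>i<k. \<theta> i) *\<^sub>R c - u' \<in> C"
      by blast
    moreover from this(2) have "r - u' \<in> C"
      by (rule drop) (simp add: \<theta>(2) sum_nonpos)
    ultimately show "\<exists>u'\<in>H (x k). u' \<preceq>\<^bsub>C\<^esub> u"
      using \<open>u = Fin r\<close> by (intro bexI[of _ "Fin u'"]) auto
  qed
  have succ: "H (x (Suc k)) \<preceq>\<^sup>l\<^bsub>C\<^esub> H (x k)" for k
    unfolding lower_set_le_def
  proof
    fix u assume u: "u \<in> H (x k)"
    then obtain r where "u = Fin r"
      using H_elem by blast
    with step[of r k] u obtain u' where "Fin u' \<in> H (x (Suc k))" "r + \<theta> k *\<^sub>R c - u' \<in> C"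
      by blast
    then show "\<exists>u'\<in>H (x (Suc k)). u' \<preceq>\<^bsub>C\<^esub> u"
      using drop \<theta>(2) \<open>u = Fin r\<close> by (intro bexI[of _ "Fin u'"]) auto
  qed
  \<comment> \<open>The boundedness hypothesis is applied to the sets \<open>H (x k)\<close>:
    \<open>below\<close> places all iterates in the initial level set, and \<open>succ\<close> makes
    the sets a chain.\<close>
  obtain T where T: "bounded T" "\<And>k. Fin ` T \<preceq>\<^sup>l\<^bsub>C\<^esub> H (x k)"
    using chains_bounded[of "\<lambda>k. H (x k)"] below succ x_init unfolding \<L>_def by blast
  obtain B where B: "\<And>t. t \<in> T \<Longrightarrow> norm t \<le> B"
    using T(1) by (auto simp: bounded_iff)
  obtain z where z: "z \<in> dual_cone C" "norm z = 1"
    using unit_dual_nonempty[OF cone] by blast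
  have cz: "0 < c \<bullet> z"
    using interior_dual_pos[OF c(1) z(1)] z(2) by fastforce
  have "h 1 (x 0) \<in> H (x 0)"
    using p by (auto simp: H_def Hmap_def)
  then obtain u0 where u0: "Fin u0 \<in> H (x 0)"
    using H_elem by metis
  \<comment> \<open>Pairing \<open>u0 + s *\<^sub>R c - t \<in> C\<close> with \<open>z\<close> and
    bounding \<open>- (t \<bullet> z)\<close> by \<open>B\<close> gives \<open>- s \<le> M\<close>,
    where \<open>s\<close> is a partial sum.\<close>
  define M where "M = (u0 \<bullet> z + B) / (c \<bullet> z)"
  have sum_bound: "(\<Sum>i<k. \<bar>\<theta> i\<bar>) \<le> M" for k
  proof -
    define s where "s = (\<Sum>i<k. \<theta> i)"
    obtain u where u: "Fin u \<in> H (x k)" "u0 + s *\<^sub>R c - u \<in> C"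
      using chain[OF u0, of k] unfolding s_def by blast
    obtain t where t: "t \<in> T" "u - t \<in> C"
      using T(2)[of k] u(1) unfolding lower_set_le_def by fastforce
    \<comment> \<open>The element \<open>u\<close> of \<open>H (x k)\<close> cancels, so the bound
      does not depend on \<open>k\<close>.\<close>
    have "0 \<le> (u0 + s *\<^sub>R c - u + (u - t)) \<bullet> z"
      using cone_add[OF C(2,3) u(2) t(2)] z(1) unfolding dual_cone_def by blast
    moreover have "- (t \<bullet> z) \<le> B"
      using norm_cauchy_schwarz[of "- t" z] B[OF t(1)] z(2) by simp
    ultimately have "- s * (c \<bullet> z) \<le> u0 \<bullet> z + B"
      by (simp add: inner_add_left inner_diff_left)
    then have "- s \<le> M"
      using cz by (simp add: M_def pos_le_divide_eq)
    then show ?thesis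
      using \<theta>(2) by (simp add: s_def abs_of_nonpos sum_negf)
  qed
  have "0 \<le> M"
    using sum_bound[of 0] by simp
  show ?thesis
  \<comment> \<open>Adding 1 makes the constant positive and the final inequality strict: if the
    first \<open>K\<close> terms were all at least \<open>(M + 1) / K\<close>, their sum would
    exceed \<open>M\<close>.\<close>
  proof (intro exI[of _ "M + 1"] conjI allI impI)
    show "0 < M + 1"
      using \<open>0 \<le> M\<close> by simp
    fix K :: nat assume "1 \<le> K"
    have "\<exists>k\<in>{0..K}. \<bar>\<theta> k\<bar> < (M + 1) / real K"
    proof (rule ccontr)
      assume "\<not> ?thesis"
      then have "real (card {..<K}) * ((M + 1) / real K) \<le> (\<Sum>k<K. \<bar>\<theta> k\<bar>)"
        by (intro sum_bounded_below) (auto simp: not_less)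
      then show False
        using sum_bound[of K] \<open>1 \<le> K\<close> by simp
    qed
    then show "\<exists>k\<in>{0..K}. \<bar>Theta C p f g e l (x k)\<bar> < ereal ((M + 1) / real K)"
      by (simp add: \<theta>(1))
  qed
qed

end
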